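(* Let $A,B$ be compact subsets of $\mathbb{R}$ such that $\overline{d}(B,x)>0$ for every $x\in B$. Then there is a closed null set $N\subset A$ such that $N+B=A+B$.
   Context: A set is null if its Lebesgue measure is $0$. For $E,F\subset\mathbb{R}$, $E+F=\{e+f : e\in E,\ f\in F\}$. For a Lebesgue measurable set $E\subset\mathbb{R}$, with $|\cdot|$ denoting Lebesgue measure, the upper density of $E$ at $x$ is $\overline{d}(E,x)=\limsup_{h\to 0^+}\frac{|E\cap[x-h,x+h]|}{2h}$. *)

theory Defs
  imports "HOL-Analysis.Analysis" "HOL-Library.Set_Algebras"
begin

text \<open>
  The limit superior is taken in the extended reals because \<^typ>\<open>real\<close> is not a complete lattice;
  for \<open>h > 0\<close> the quotient lies in \<open>[0, 1]\<close>, so the value is always finite.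
\<close>
definition upper_density :: "real set \<Rightarrow> real \<Rightarrow> ereal" where
  "upper_density E x =
     Limsup (at_right 0) (\<lambda>h. ereal (measure lebesgue (E \<inter> {x - h..x + h}) / (2 * h)))"

end

(* Remove from A as large an open set as possible without changing the sumset with B (Zorn; the
   finite intersection property for the compact sets A \<inter> (s - B) handles chains). If what is left,
   N, were not null, it would have a density point x. Comparing densities at x and at b, the set
   N \<inter> (x + b - B) has positive measure for every b in B. This measure is continuous in x + b and B
   is compact, so for s in a neighbourhood of x + B the measure of N \<inter> (s - B) exceeds that of a small
   ball around x: the ball can be removed as well, contradicting maximality. *)
theory Submission
  imports Defs
begin

section \<open>Reflections and Lebesgue measure\<close>

lemma measure_lebesgue_reflect:
  fixes c :: real
  shows "measure lebesgue ((\<lambda>y. c - y) ` S) = measure lebesgue S"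
  using measure_lebesgue_affine[of "-1" c S] by simp

text \<open>Negation is its own inverse, so its image of \<open>S\<close> is the preimage of
  \<open>S\<close> under scaling by \<open>- 1\<close>; translating by \<open>c\<close> gives the
  reflection.\<close>

lemma sets_lebesgue_reflect:
  fixes c :: real
  assumes "S \<in> sets lebesgue"
  shows "(\<lambda>y. c - y) ` S \<in> sets lebesgue"
proof -
  have "(*\<^sub>R) (- 1) -` S \<in> sets lebesgue"
    using measurable_sets[OF lebesgue_measurable_scaling assms, of "- 1"] by simp
  moreover have "(*\<^sub>R) (- 1) -` S = uminus ` S"
    by force
  moreover have "(\<lambda>y. c - y) ` S = (+) c ` uminus ` S"
    by (simp add: image_image)
  ultimately show ?thesis
    by (simp add: lebesgue_sets_translation)
qed

lemma lmeasurable_reflect: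
  fixes c :: real
  assumes "S \<in> lmeasurable"
  shows "(\<lambda>y. c - y) ` S \<in> lmeasurable"
proof -
  have "emeasure lebesgue ((\<lambda>y. c - y) ` S) = emeasure lebesgue S"
    using emeasure_lebesgue_affine[of "-1" c S] by simp
  then show ?thesis
    using assms sets_lebesgue_reflect by (simp add: fmeasurable_def del: emeasure_completion)
qed

section \<open>Lebesgue density points\<close>

text \<open>Lebesgue differentiation for boxes with corner \<open>x\<close>, applied to the
  indicator of \<open>- A\<close>: at a point of \<open>A\<close> this indicator is 0, so its
  averages over \<open>{x..x+h}\<close> tend to 0 for almost every such point.\<close>

lemma ae_right_density_point:
  fixes A :: "real set"
  assumes "A \<in> sets lebesgue"
  obtains N where "negligible N"
    "\<And>x e. x \<in> A - N \<Longrightarrow> 0 < e \<Longrightarrow>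
       \<exists>d>0. \<forall>h. 0 < h \<and> h < d \<longrightarrow> measure lebesgue ({x..x+h} - A) < e * h"
proof -
  have lm: "{a..b} - A \<in> lmeasurable" for a b :: real
    using assms by (intro fmeasurable_Diff) auto
  have int: "((indicator (- A) :: real \<Rightarrow> real) has_integral measure lebesgue ({a..b} - A)) {a..b}"
    for a b
  proof -
    have "(indicat_real ({a..b} - A) has_integral measure lebesgue ({a..b} - A)) UNIV"
      using lm lmeasurable_iff_has_integral by blast
    moreover have "indicat_real ({a..b} - A) =
        (\<lambda>y. if y \<in> {a..b} then indicator (- A) y else 0)"
      by (auto simp: indicator_def)
    ultimately show ?thesis
      by (simp only: has_integral_restrict_UNIV)
  qed
  have "(indicator (- A) :: real \<Rightarrow> real) integrable_on cbox a b" for a b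
    using int[of a b] by (auto simp: integrable_on_def)
  then obtain N where N: "negligible N"
    "\<And>x e. \<lbrakk>x \<notin> N; 0 < e\<rbrakk> \<Longrightarrow> \<exists>d>0. \<forall>h. 0 < h \<and> h < d \<longrightarrow>
       norm (integral (cbox x (x + h *\<^sub>R One)) (indicator (- A) :: real \<Rightarrow> real) /\<^sub>R h ^ DIM(real)
             - indicator (- A) x) < e"
    using integrable_ccontinuous_explicit[of "indicator (- A) :: real \<Rightarrow> real"] by blast
  show thesis
  proof
    fix x e :: real
    assume "x \<in> A - N" "0 < e"
    then obtain d where d: "d > 0" "\<And>h. 0 < h \<Longrightarrow> h < d \<Longrightarrow>
        norm (integral (cbox x (x + h *\<^sub>R One)) (indicator (- A) :: real \<Rightarrow> real) /\<^sub>R h ^ DIM(real)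
             - indicator (- A) x) < e"
      using N(2)[of x e] by blast
    have "measure lebesgue ({x..x+h} - A) < e * h" if h: "0 < h" "h < d" for h
      using d(2)[OF h] integral_unique[OF int[of x "x + h"]] h(1) \<open>x \<in> A - N\<close>
      by (simp add: field_simps)
    then show "\<exists>d>0. \<forall>h. 0 < h \<and> h < d \<longrightarrow> measure lebesgue ({x..x+h} - A) < e * h"
      using d(1) by blast
  qed (rule N(1))
qed

lemma ae_density_point:
  fixes A :: "real set"
  assumes "A \<in> sets lebesgue"
  obtains N where "negligible N"
    "\<And>x e. x \<in> A - N \<Longrightarrow> 0 < e \<Longrightarrow>
       \<exists>d>0. \<forall>h. 0 < h \<and> h < d \<longrightarrow> measure lebesgue ({x-h..x+h} - A) < e * (2 * h)"
proof -
  have mA: "uminus ` A \<in> sets lebesgue"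
    using sets_lebesgue_reflect[OF assms, of 0] by simp
  have lm: "{a..b} - A \<in> lmeasurable" for a b :: real
    using assms by (intro fmeasurable_Diff) auto
  obtain N where N: "negligible N"
    "\<And>x e. x \<in> A - N \<Longrightarrow> 0 < e \<Longrightarrow>
       \<exists>d>0. \<forall>h. 0 < h \<and> h < d \<longrightarrow> measure lebesgue ({x..x+h} - A) < e * h"
    using ae_right_density_point[OF assms] by blast
  obtain M where M: "negligible M"
    "\<And>x e. x \<in> uminus ` A - M \<Longrightarrow> 0 < e \<Longrightarrow>
       \<exists>d>0. \<forall>h. 0 < h \<and> h < d \<longrightarrow> measure lebesgue ({x..x+h} - uminus ` A) < e * h"
    using ae_right_density_point[OF mA] by blast
  have im: "y \<in> (\<lambda>z. 0 - z) ` S \<longleftrightarrow> - y \<in> S" "y \<in> uminus ` S \<longleftrightarrow> - y \<in> S"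
    for y :: real and S
    using image_eqI[of y uminus "- y" S] by auto
  show thesis
  proof
    show "negligible (N \<union> uminus ` M)"
      using N(1) M(1)
      by (intro negligible_Un negligible_differentiable_image_negligible
          linear_imp_differentiable_on) (auto intro: linearI)
    fix x e :: real
    assume x: "x \<in> A - (N \<union> uminus ` M)" and "0 < e"
    have mx: "- x \<in> uminus ` A - M"
      using x by (simp add: im)
    then obtain d' where d': "d' > 0"
      "\<And>h. 0 < h \<Longrightarrow> h < d' \<Longrightarrow> measure lebesgue ({-x..-x+h} - uminus ` A) < e * h"
      using M(2)[OF mx \<open>0 < e\<close>] by blast
    obtain d where d: "d > 0"
      "\<And>h. 0 < h \<Longrightarrow> h < d \<Longrightarrow> measure lebesgue ({x..x+h} - A) < e * h"
      using N(2)[of x e] x \<open>0 < e\<close> by blast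
    have "measure lebesgue ({x-h..x+h} - A) < e * (2 * h)" if h: "0 < h" "h < min d d'" for h
    proof -
      have "{-x..-x+h} - uminus ` A = (\<lambda>y. 0 - y) ` ({x-h..x} - A)"
        by (auto simp: im)
      then have "measure lebesgue ({-x..-x+h} - uminus ` A) = measure lebesgue ({x-h..x} - A)"
        by (simp only: measure_lebesgue_reflect)
      moreover have "measure lebesgue ({x-h..x+h} - A) \<le>
          measure lebesgue (({x-h..x} - A) \<union> ({x..x+h} - A))"
        by (rule measure_mono_fmeasurable) (use lm in auto)
      moreover have "\<dots> \<le> measure lebesgue ({x-h..x} - A) + measure lebesgue ({x..x+h} - A)"
        using lm by (intro measure_Un_le) auto
      ultimately show ?thesis
        using d(2)[of h] d'(2)[of h] h by simp
    qed
    then show "\<exists>d>0. \<forall>h. 0 < h \<and> h < d \<longrightarrow> measure lebesgue ({x-h..x+h} - A) < e * (2 * h)"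
      using d(1) d'(1) by (intro exI[of _ "min d d'"]) auto
  qed
qed

section \<open>The measure of \<open>A\<close> intersected with a reflected copy of
  \<open>B\<close>\<close>

text \<open>The reflection exchanges \<open>b\<close> and \<open>x\<close>. At a suitable small
  scale the reflected \<open>B\<close> fills more of \<open>{x-h..x+h}\<close> than \<open>A\<close>
  leaves free, so the two overlap in positive measure. Upper density supplies only some small
  \<open>h\<close>, which is enough because the bound for \<open>A\<close> holds for all small
  \<open>h\<close>.\<close>

lemma measure_Int_reflect_pos:
  fixes A B :: "real set"
  assumes "A \<in> sets lebesgue" "B \<in> lmeasurable"
    and x: "\<And>e. 0 < e \<Longrightarrow>
       \<exists>d>0. \<forall>h. 0 < h \<and> h < d \<longrightarrow> measure lebesgue ({x-h..x+h} - A) < e * (2 * h)"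
    and b: "upper_density B b > 0"
  shows "measure lebesgue (A \<inter> (\<lambda>y. x + b - y) ` B) > 0"
proof -
  \<comment> \<open>\<open>c\<close> is a proportion that \<open>B\<close> exceeds near
    \<open>b\<close> at arbitrarily small scales; it also serves as the \<open>e\<close> in the
    density hypothesis on \<open>A\<close>.\<close>
  obtain c where c: "0 < c" "ereal c < upper_density B b"
    using ereal_dense2[OF b] by auto
  have freq: "\<exists>\<^sub>F h in at_right 0.
      ereal c < ereal (measure lebesgue (B \<inter> {b - h..b + h}) / (2 * h))"
  proof (rule ccontr)
    assume "\<not> ?thesis"
    then have "\<forall>\<^sub>F h in at_right 0.
        ereal (measure lebesgue (B \<inter> {b - h..b + h}) / (2 * h)) \<le> ereal c"
      by (simp only: not_frequently not_less)
    then have "upper_density B b \<le> ereal c"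
      unfolding upper_density_def by (rule Limsup_bounded)
    then show False
      using c(2) by simp
  qed
  obtain d where d: "d > 0"
    "\<And>h. 0 < h \<Longrightarrow> h < d \<Longrightarrow> measure lebesgue ({x-h..x+h} - A) < c * (2 * h)"
    using x[OF c(1)] by blast
  have "\<forall>\<^sub>F h in at_right 0. 0 < h \<and> h < d"
    using d(1) by (auto simp: eventually_at_right)
  from frequently_eventually_frequently[OF freq this] obtain h where h: "0 < h" "h < d"
    and "c < measure lebesgue (B \<inter> {b - h..b + h}) / (2 * h)"
    by (auto dest: frequently_ex)
  then have B: "c * (2 * h) < measure lebesgue (B \<inter> {b - h..b + h})"
    by (simp add: field_simps)
  define R where "R = (\<lambda>y. x + b - y) ` (B \<inter> {b - h..b + h})"
  have R: "R \<in> lmeasurable" "(\<lambda>y. x + b - y) ` B \<in> lmeasurable"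
    unfolding R_def using assms(2) by (auto intro!: lmeasurable_reflect fmeasurable_Int_fmeasurable)
  have AR: "A \<inter> R \<in> lmeasurable" "A \<inter> (\<lambda>y. x + b - y) ` B \<in> lmeasurable"
    using R[THEN fmeasurable_Int_fmeasurable, OF assms(1)] by (simp_all only: Int_commute)
  have D: "{x-h..x+h} - A \<in> lmeasurable"
    using assms(1) by (intro fmeasurable_Diff) auto
  have "R \<subseteq> {x-h..x+h}"
    by (auto simp: R_def)
  then have "measure lebesgue R \<le> measure lebesgue ((A \<inter> R) \<union> ({x-h..x+h} - A))"
    using R AR D by (intro measure_mono_fmeasurable) auto
  also have "\<dots> \<le> measure lebesgue (A \<inter> R) + measure lebesgue ({x-h..x+h} - A)"
    using AR D by (intro measure_Un_le) auto
  finally have "0 < measure lebesgue (A \<inter> R)"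
    using B d(2)[OF h] by (simp add: R_def measure_lebesgue_reflect)
  also have "\<dots> \<le> measure lebesgue (A \<inter> (\<lambda>y. x + b - y) ` B)"
    using AR by (intro measure_mono_fmeasurable) (auto simp: R_def)
  finally show ?thesis .
qed

text \<open>An open \<open>T\<close> containing \<open>B\<close> exceeds it by measure less than
  \<open>e\<close>, and by compactness small shifts of \<open>B\<close> stay inside
  \<open>T\<close>. Exchanging \<open>s\<close> and \<open>t\<close> gives the reverse bound, hence
  uniform continuity.\<close>

lemma measure_Int_reflect_uniform:
  fixes A B :: "real set"
  assumes "A \<in> sets lebesgue" "compact B" "0 < e"
  obtains r where "0 < r"
    "\<And>s t. dist s t < r \<Longrightarrow> measure lebesgue (A \<inter> (\<lambda>y. t - y) ` B) \<le>
                              measure lebesgue (A \<inter> (\<lambda>y. s - y) ` B) + e"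
proof -
  have B: "B \<in> lmeasurable"
    using assms(2) by (rule lmeasurable_compact)
  obtain T where T: "open T" "B \<subseteq> T" "T - B \<in> lmeasurable" "emeasure lebesgue (T - B) < ennreal e"
    using sets_lebesgue_outer_open[of B e] B assms(3) by (auto simp: fmeasurableD)
  have TB: "measure lebesgue (T - B) < e"
    using T(3,4) by (metis emeasure_eq_measure2 ennreal_less_iff measure_nonneg)
  obtain r where r: "r > 0" "(\<Union>y\<in>B. ball y r) \<subseteq> T"
    using compact_subset_open_imp_ball_epsilon_subset[OF assms(2) T(1,2)] by blast
  have m: "A \<inter> (\<lambda>y. s - y) ` B \<in> lmeasurable" for s
    using fmeasurable_Int_fmeasurable[OF lmeasurable_reflect[OF B] assms(1)]
    by (simp add: inf_commute)
  show thesis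
  proof
    fix s t :: real
    assume "dist s t < r"
    have *: "(\<lambda>y. t - y) ` B \<subseteq> (\<lambda>y. s - y) ` B \<union> (\<lambda>y. s - y) ` (T - B)"
    proof clarify
      fix y assume "y \<in> B" "t - y \<notin> (\<lambda>y. s - y) ` (T - B)"
      \<comment> \<open>The point \<open>t - y\<close> is also the reflection about \<open>s\<close>
        of \<open>y\<close> shifted by \<open>s - t\<close>, a shift shorter than
        \<open>r\<close>.\<close>
      moreover have "y + (s - t) \<in> T"
        using r(2) \<open>y \<in> B\<close> \<open>dist s t < r\<close> by (force simp: dist_real_def)
      moreover have "t - y = s - (y + (s - t))"
        by simp
      ultimately show "t - y \<in> (\<lambda>y. s - y) ` B"
        by (metis DiffI imageI)
    qed
    have "measure lebesgue (A \<inter> (\<lambda>y. t - y) ` B) \<le>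
        measure lebesgue ((A \<inter> (\<lambda>y. s - y) ` B) \<union> (\<lambda>y. s - y) ` (T - B))"
      using * m lmeasurable_reflect[OF T(3)] by (intro measure_mono_fmeasurable) auto
    also have "\<dots> \<le> measure lebesgue (A \<inter> (\<lambda>y. s - y) ` B) + measure lebesgue ((\<lambda>y. s - y) ` (T - B))"
      using m lmeasurable_reflect[OF T(3)] by (intro measure_Un_le) auto
    finally show "measure lebesgue (A \<inter> (\<lambda>y. t - y) ` B) \<le>
        measure lebesgue (A \<inter> (\<lambda>y. s - y) ` B) + e"
      using TB by (simp add: measure_lebesgue_reflect)
  qed (rule r(1))
qed

section \<open>Sumsets and the removal of small balls\<close>

text \<open>The intersection consists of the first summands \<open>a\<close> in all representations
  \<open>s = a + b\<close>.\<close>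

lemma mem_set_plus_iff_reflect:
  fixes A B :: "'a::ab_group_add set"
  shows "s \<in> A + B \<longleftrightarrow> A \<inter> (\<lambda>y. s - y) ` B \<noteq> {}"
proof
  assume "A \<inter> (\<lambda>y. s - y) ` B \<noteq> {}"
  then obtain y where "y \<in> B" "s - y \<in> A"
    by blast
  then have "(s - y) + y \<in> A + B"
    by (rule set_plus_intro[rotated])
  then show "s \<in> A + B"
    by simp
next
  assume "s \<in> A + B"
  then obtain a b where "s = a + b" "a \<in> A" "b \<in> B"
    by (rule set_plus_elim)
  then have "a \<in> A \<inter> (\<lambda>y. s - y) ` B"
    by (auto intro: image_eqI[of _ _ b])
  then show "A \<inter> (\<lambda>y. s - y) ` B \<noteq> {}"
    by blast
qed

text \<open>If \<open>s = a + b\<close> with \<open>a\<close> close to \<open>x\<close>, then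
  \<open>s\<close> is close to \<open>x + b\<close>, so the set of possible first summands has
  measure at least a constant independent of \<open>b\<close>. It cannot fit into a small enough
  ball, and a first summand outside the ball represents \<open>s\<close> instead.\<close>

lemma removable_ball:
  fixes A B :: "real set"
  assumes "A \<in> sets lebesgue" "compact B"
    and pos: "\<And>b. b \<in> B \<Longrightarrow> measure lebesgue (A \<inter> (\<lambda>y. x + b - y) ` B) > 0"
  obtains r where "0 < r" "(A - ball x r) + B = A + B"
proof (cases "B = {}")
  case True
  then show ?thesis
    using that[of 1] by (auto simp: set_plus_def)
next
  case False
  define g where "g = (\<lambda>s. measure lebesgue (A \<inter> (\<lambda>y. s - y) ` B))"
  have cont: "continuous_on UNIV g"
    unfolding continuous_on_iff
  proof clarify
    fix s e :: real
    assume "0 < e"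
    then obtain r where "0 < r" "\<And>s t. dist s t < r \<Longrightarrow> g t \<le> g s + e / 2"
      using measure_Int_reflect_uniform[OF assms(1,2), of "e / 2"] unfolding g_def
      by (metis half_gt_zero)
    then have "dist (g t) (g s) < e" if "dist t s < r" for t
      using that \<open>0 < e\<close> by (smt (verit) dist_commute dist_real_def field_sum_of_halves)
    then show "\<exists>d>0. \<forall>t\<in>UNIV. dist t s < d \<longrightarrow> dist (g t) (g s) < e"
      using \<open>0 < r\<close> by blast
  qed
  have "continuous_on B (\<lambda>b. g (x + b))"
    by (rule continuous_on_compose2[OF cont]) (auto intro: continuous_intros)
  then obtain b0 where b0: "b0 \<in> B" "\<And>b. b \<in> B \<Longrightarrow> g (x + b0) \<le> g (x + b)"
    using continuous_attains_inf[OF assms(2) False] by blast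
  \<comment> \<open>Half of the minimum over \<open>B\<close> may be lost when passing from
    \<open>x + b\<close> to a nearby \<open>s\<close>; the other half, again \<open>e\<close>,
    remains as a lower bound for \<open>g s\<close>.\<close>
  define e where "e = g (x + b0) / 2"
  have "e > 0"
    using pos[OF b0(1)] by (simp add: e_def g_def)
  obtain r0 where r0: "0 < r0" "\<And>s t. dist s t < r0 \<Longrightarrow> g t \<le> g s + e"
    using measure_Int_reflect_uniform[OF assms(1,2) \<open>e > 0\<close>] unfolding g_def by metis
  \<comment> \<open>The bound \<open>r0\<close> controls the change of \<open>g\<close>, since
    \<open>s - (x + b) = a - x\<close>; the bound \<open>e / 3\<close> makes the length
    \<open>2 * r\<close> of the ball less than \<open>e\<close>.\<close>
  define r where "r = min r0 (e / 3)"
  have "0 < r"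
    using r0(1) \<open>e > 0\<close> by (simp add: r_def)
  moreover have "s \<in> (A - ball x r) + B" if s: "s \<in> A + B" for s
  proof -
    from s obtain a b where ab: "s = a + b" "a \<in> A" "b \<in> B"
      by (rule set_plus_elim)
    show ?thesis
    proof (cases "a \<in> ball x r")
      case True
      then have "dist s (x + b) < r0"
        using ab(1) by (auto simp: r_def dist_real_def)
      then have "g (x + b) \<le> g s + e"
        by (rule r0(2))
      then have "e \<le> g s"
        using b0(2)[OF ab(3)] by (simp add: e_def)
      moreover have "measure lebesgue (ball x r) = 2 * r"
        using \<open>0 < r\<close> by (simp add: ball_eq_greaterThanLessThan)
      moreover have "2 * r < e"
        using \<open>e > 0\<close> by (simp add: r_def min_def)
      ultimately have "\<not> g s \<le> measure lebesgue (ball x r)"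
        by simp
      moreover have "A \<inter> (\<lambda>y. s - y) ` B \<in> sets lebesgue"
        using assms(1) lmeasurable_compact[OF assms(2)]
        by (rule sets.Int[OF _ fmeasurableD[OF lmeasurable_reflect]])
      ultimately have "\<not> A \<inter> (\<lambda>y. s - y) ` B \<subseteq> ball x r"
        unfolding g_def using measure_mono_fmeasurable[OF _ _ lmeasurable_ball] by blast
      then show ?thesis
        unfolding mem_set_plus_iff_reflect by blast
    next
      case False
      then show ?thesis
        using ab by auto
    qed
  qed
  moreover have "(A - ball x r) + B \<subseteq> A + B"
    by (rule set_plus_mono2) auto
  ultimately show thesis
    using that[of r] by blast
qed

section \<open>A maximal removable open set\<close>

theorem theorem1p5:
  fixes A B :: "real set"
  assumes "compact A" and "compact B"
    and "\<forall>x\<in>B. upper_density B x > 0"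
  shows "\<exists>N. N \<subseteq> A \<and> closed N \<and> N \<in> null_sets lebesgue \<and> N + B = A + B"
proof -
  define \<U> where "\<U> = {U. open U \<and> (A - U) + B = A + B}"
  have "\<exists>M\<in>\<U>. \<forall>U\<in>\<U>. M \<subseteq> U \<longrightarrow> U = M"
  proof (rule subset_Zorn_nonempty)
    show "\<U> \<noteq> {}"
      by (auto simp: \<U>_def intro!: exI[of _ "{}"])
    fix \<C> assume \<C>: "\<C> \<noteq> {}" "subset.chain \<U> \<C>"
    then have sub: "\<C> \<subseteq> \<U>"
      by (simp add: subset_chain_def)
    have "s \<in> (A - \<Union>\<C>) + B" if s: "s \<in> A + B" for s
    proof (rule ccontr)
      assume "s \<notin> (A - \<Union>\<C>) + B"
      \<comment> \<open>Losing \<open>s\<close> means that the chain covers the compact set of its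
        first summands. Finitely many members then suffice, and the largest of them already loses
        \<open>s\<close>, although it belongs to \<open>\<U>\<close>.\<close>
      then have K: "A \<inter> (\<lambda>y. s - y) ` B \<subseteq> \<Union>\<C>"
        unfolding mem_set_plus_iff_reflect by blast
      have cpt: "compact (A \<inter> (\<lambda>y. s - y) ` B)"
        using assms(1,2) by (intro compact_Int compact_continuous_image continuous_intros)
      obtain \<F> where \<F>: "\<F> \<subseteq> \<C>" "finite \<F>" "A \<inter> (\<lambda>y. s - y) ` B \<subseteq> \<Union>\<F>"
        using compactE[OF cpt K] sub unfolding \<U>_def by blast
      \<comment> \<open>Nonemptiness is needed for a finite subchain to contain its own union as its
        largest member.\<close>
      have "\<F> \<noteq> {}"
        using s \<F>(3) unfolding mem_set_plus_iff_reflect by auto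
      moreover have "subset.chain \<U> \<F>"
        using \<C>(2) \<F>(1) unfolding subset_chain_def by blast
      ultimately have U: "\<Union>\<F> \<in> \<C>"
        using \<F>(1,2) Union_in_chain by blast
      then have "s \<in> (A - \<Union>\<F>) + B"
        using sub s U by (auto simp: \<U>_def)
      then show False
        using \<F>(3) unfolding mem_set_plus_iff_reflect by blast
    qed
    moreover have "(A - \<Union>\<C>) + B \<subseteq> A + B"
      by (rule set_plus_mono2) auto
    ultimately show "\<Union>\<C> \<in> \<U>"
      using sub by (auto simp: \<U>_def)
  qed
  then obtain M where M: "open M" "(A - M) + B = A + B"
    and max: "\<And>U. open U \<Longrightarrow> (A - U) + B = A + B \<Longrightarrow> M \<subseteq> U \<Longrightarrow> U = M"
    by (auto simp: \<U>_def)
  define N where "N = A - M"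
  have "compact N"
    unfolding N_def using assms(1) M(1) by (rule compact_diff)
  then have N: "N \<in> sets lebesgue"
    by (simp add: lmeasurable_compact fmeasurableD)
  obtain Z where Z: "negligible Z" "\<And>x e. x \<in> N - Z \<Longrightarrow> 0 < e \<Longrightarrow>
       \<exists>d>0. \<forall>h. 0 < h \<and> h < d \<longrightarrow> measure lebesgue ({x-h..x+h} - N) < e * (2 * h)"
    using ae_density_point[OF N] by blast
  \<comment> \<open>No point of \<open>N\<close> can be a density point, so \<open>N\<close> lies in
    the exceptional set \<open>Z\<close>.\<close>
  have "x \<in> Z" if "x \<in> N" for x
  proof (rule ccontr)
    assume "x \<notin> Z"
    then have "measure lebesgue (N \<inter> (\<lambda>y. x + b - y) ` B) > 0" if "b \<in> B" for b
      using that \<open>x \<in> N\<close> assms(2,3) Z(2) N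
      by (intro measure_Int_reflect_pos) (auto intro: lmeasurable_compact)
    then obtain r where r: "0 < r" "(N - ball x r) + B = N + B"
      using removable_ball[OF N assms(2)] by blast
    \<comment> \<open>Enlarging \<open>M\<close> by the ball still leaves the sumset
      \<open>N + B = A + B\<close>, so maximality puts \<open>x\<close> into \<open>M\<close>,
      against \<open>x\<close> being in \<open>N\<close>.\<close>
    have "A - (M \<union> ball x r) = N - ball x r"
      by (auto simp: N_def)
    then have "M \<union> ball x r = M"
      using M r(2) by (intro max) (auto simp: N_def)
    moreover have "x \<in> ball x r"
      using r(1) by simp
    ultimately show False
      using \<open>x \<in> N\<close> unfolding N_def by blast
  qed
  then have "N \<in> null_sets lebesgue"
    using Z(1) negligible_subset[of Z N] by (auto simp only: negligible_iff_null_sets[symmetric])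
  moreover have "closed N"
    using \<open>compact N\<close> by (rule compact_imp_closed)
  moreover have "N \<subseteq> A" "N + B = A + B"
    using M(2) by (simp_all add: N_def)
  ultimately show ?thesis
    by blast
qed

end
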